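(* Let $G$ be a finite group, $H\le G$ a subgroup, $x\in G$, let $e\in\mathbb{C}[H]$ be an idempotent and let $L=\mathbb{C}[G]e$. Then \[\dim\bigl(\mathrm{RId}_{\mathbb{C}[HxH]}(L)\bigr)=|HxH|-\Bigl\langle\chi_{\mathbb{C}[H]e}\big\downarrow_{H\cap xHx^{-1}},\ \bigl(\chi^{x^{-1}}_{\mathbb{C}[H](1-e)}\bigr)\big\downarrow_{H\cap xHx^{-1}}\Bigr\rangle .\]
   Context: For $K\subseteq G$, $\mathbb{C}[K]$ is the linear span of $K$ in $\mathbb{C}[G]$. $\mathrm{RId}_{\mathbb{C}[HxH]}(L)=\{w\in\mathbb{C}[HxH]:Lw\subseteq L\}$. For a left $\mathbb{C}[H]$-module $M$, $\chi_M$ is its character, and $\chi_M^{x^{-1}}$ is the conjugated character of $xHx^{-1}$ defined by $\chi_M^{x^{-1}}(k)=\chi_M(x^{-1}kx)$ for $k\in xHx^{-1}$. The arrow $\downarrow_K$ denotes restriction of a character to $K$. For characters $\chi,\psi$ of a finite group $K$ (here $K=H\cap xHx^{-1}$), $\langle\chi,\psi\rangle=\frac1{|K|}\sum_{k\in K}\overline{\chi(k)}\psi(k)$. *)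

theory Defs
  imports Complex_Main "HOL-Algebra.Coset" "HOL-Algebra.Ring" "HOL-Library.Function_Algebras"
begin

global_interpretation cfun: vector_space "\<lambda>(c::complex) (f::'a \<Rightarrow> complex) x. c * f x"
  by standard (auto simp: fun_eq_iff algebra_simps)

text \<open>Elements of the group algebra of a finite group are coefficient functions that vanish
  outside the carrier; multiplication is convolution. For infinite \<open>carrier G\<close> the record
  below is not the group algebra.\<close>

definition group_delta :: "'a \<Rightarrow> 'a \<Rightarrow> complex" where
  "group_delta g = (\<lambda>y. if y = g then 1 else 0)"

definition group_algebra :: "('a, 'b) monoid_scheme \<Rightarrow> ('a \<Rightarrow> complex) ring" where
  "group_algebra G =
    \<lparr>carrier = {a. \<forall>g. g \<notin> carrier G \<longrightarrow> a g = 0},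
     mult = (\<lambda>a b g. if g \<in> carrier G
               then \<Sum>h\<in>carrier G. a h * b (inv\<^bsub>G\<^esub> h \<otimes>\<^bsub>G\<^esub> g) else 0),
     one = group_delta \<one>\<^bsub>G\<^esub>,
     zero = 0,
     add = (+)\<rparr>"

definition group_span :: "'a set \<Rightarrow> ('a \<Rightarrow> complex) set" where
  "group_span K = cfun.span (group_delta ` K)"

text \<open>The trace on \<open>V\<close> of a linear endomorphism \<open>f\<close> of a finite-dimensional space \<open>V\<close>, read off
  from the diagonal of its matrix in some basis of \<open>V\<close>.\<close>

definition trace_on :: "('a \<Rightarrow> complex) set \<Rightarrow> (('a \<Rightarrow> complex) \<Rightarrow> ('a \<Rightarrow> complex)) \<Rightarrow> complex" where
  "trace_on V f =
    (let B = (SOME B. cfun.independent B \<and> cfun.span B = V)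
     in \<Sum>b\<in>B. cfun.representation B (f b) b)"

text \<open>The character of a submodule \<open>M\<close> of the regular module: the group acts by left
  multiplication. For a left \<open>\<complex>[H]\<close>-module \<open>M\<close> only the values on \<open>H\<close> are meaningful.\<close>

definition module_character ::
  "('a, 'b) monoid_scheme \<Rightarrow> ('a \<Rightarrow> complex) set \<Rightarrow> 'a \<Rightarrow> complex" where
  "module_character G M g = trace_on M (\<lambda>m. group_delta g \<otimes>\<^bsub>group_algebra G\<^esub> m)"

text \<open>For a character \<open>\<chi>\<close> of \<open>H\<close> this is the character \<open>\<chi>\<close> raised to \<open>x\<inverse>\<close> of \<open>xHx\<inverse>\<close>.\<close>

definition conj_character ::
  "('a, 'b) monoid_scheme \<Rightarrow> 'a \<Rightarrow> ('a \<Rightarrow> complex) \<Rightarrow> 'a \<Rightarrow> complex" where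
  "conj_character G x \<chi> k = \<chi> (inv\<^bsub>G\<^esub> x \<otimes>\<^bsub>G\<^esub> k \<otimes>\<^bsub>G\<^esub> x)"

definition character_inner :: "'a set \<Rightarrow> ('a \<Rightarrow> complex) \<Rightarrow> ('a \<Rightarrow> complex) \<Rightarrow> complex" where
  "character_inner K \<chi> \<psi> = (1 / of_nat (card K)) * (\<Sum>k\<in>K. cnj (\<chi> k) * \<psi> k)"

definition double_coset :: "('a, 'b) monoid_scheme \<Rightarrow> 'a set \<Rightarrow> 'a \<Rightarrow> 'a set" where
  "double_coset G H x = H <#>\<^bsub>G\<^esub> (x <#\<^bsub>G\<^esub> H)"

text \<open>\<open>L #> w\<close> is the set of products \<open>{l w | l \<in> L}\<close>, here in the group algebra.\<close>

definition right_idealizer ::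
  "('a, 'b) monoid_scheme \<Rightarrow> 'a set \<Rightarrow> ('a \<Rightarrow> complex) set \<Rightarrow> ('a \<Rightarrow> complex) set" where
  "right_idealizer G K L = {w \<in> group_span K. L #>\<^bsub>group_algebra G\<^esub> w \<subseteq> L}"

lemma sum_fun_apply: "(\<Sum>i\<in>I. f i) x = (\<Sum>i\<in>I. (f i :: 'a \<Rightarrow> complex) x)"
  by (induction I rule: infinite_finite_induct) auto

lemma group_span_eq:
  assumes "finite K"
  shows "group_span K = {a. \<forall>g. g \<notin> K \<longrightarrow> a g = 0}" (is "_ = ?R")
proof
  have "cfun.subspace ?R"
    by (auto simp: cfun.subspace_def)
  then show "group_span K \<subseteq> ?R"
    unfolding group_span_def by (intro cfun.span_minimal) (auto simp: group_delta_def)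
next
  show "?R \<subseteq> group_span K"
  proof
    fix a assume a: "a \<in> ?R"
    have "a = (\<Sum>k\<in>K. (\<lambda>x. a k * group_delta k x))"
    proof
      fix x
      have "(\<Sum>k\<in>K. a k * group_delta k x) = (\<Sum>k\<in>K. if k = x then a x else 0)"
        by (intro sum.cong) (auto simp: group_delta_def)
      also have "\<dots> = a x"
        using a assms by auto
      finally show "a x = (\<Sum>k\<in>K. (\<lambda>x. a k * group_delta k x)) x"
        by (simp add: sum_fun_apply)
    qed
    also have "\<dots> \<in> group_span K"
      unfolding group_span_def
      by (intro cfun.span_sum cfun.span_scale cfun.span_base) auto
    finally show "a \<in> group_span K" .
  qed
qed

corollary carrier_group_algebra:
  "finite (carrier G) \<Longrightarrow> carrier (group_algebra G) = group_span (carrier G)"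
  by (simp add: group_span_eq group_algebra_def)

lemma (in group) group_delta_mult:
  assumes "finite (carrier G)" "g \<in> carrier G" "h \<in> carrier G"
  shows "group_delta g \<otimes>\<^bsub>group_algebra G\<^esub> group_delta h = group_delta (g \<otimes> h)"
proof
  fix y
  have *: "inv g \<otimes> y = h \<longleftrightarrow> y = g \<otimes> h" if "y \<in> carrier G"
    using inv_solve_left[of h g y] that assms by auto
  have "(\<Sum>z\<in>carrier G. group_delta g z * group_delta h (inv z \<otimes> y)) =
        (\<Sum>z\<in>carrier G. if z = g then group_delta h (inv g \<otimes> y) else 0)"
    by (intro sum.cong) (auto simp: group_delta_def)
  then show "(group_delta g \<otimes>\<^bsub>group_algebra G\<^esub> group_delta h) y = group_delta (g \<otimes> h) y"
    using assms * by (auto simp: group_algebra_def group_delta_def)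
qed

lemma (in group) ring_group_algebra:
  assumes fin: "finite (carrier G)"
  shows "ring (group_algebra G)"
proof (rule ringI)
  show "abelian_group (group_algebra G)"
  proof (rule abelian_groupI)
    fix a assume "a \<in> carrier (group_algebra G)"
    then show "\<exists>b\<in>carrier (group_algebra G).
        b \<oplus>\<^bsub>group_algebra G\<^esub> a = \<zero>\<^bsub>group_algebra G\<^esub>"
      by (intro bexI[of _ "- a"]) (auto simp: group_algebra_def)
  qed (auto simp: group_algebra_def fun_eq_iff)
  show "monoid (group_algebra G)"
  proof
    fix a assume a: "a \<in> carrier (group_algebra G)"
    show "\<one>\<^bsub>group_algebra G\<^esub> \<otimes>\<^bsub>group_algebra G\<^esub> a = a"
    proof
      fix g
      have "(\<Sum>h\<in>carrier G. group_delta \<one> h * a (inv h \<otimes> g)) =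
            (\<Sum>h\<in>carrier G. if h = \<one> then a (inv \<one> \<otimes> g) else 0)"
        by (intro sum.cong) (auto simp: group_delta_def)
      then show "(\<one>\<^bsub>group_algebra G\<^esub> \<otimes>\<^bsub>group_algebra G\<^esub> a) g = a g"
        using a fin by (auto simp: group_algebra_def)
    qed
    show "a \<otimes>\<^bsub>group_algebra G\<^esub> \<one>\<^bsub>group_algebra G\<^esub> = a"
    proof
      fix g
      have "(\<Sum>h\<in>carrier G. a h * group_delta \<one> (inv h \<otimes> g)) =
            (\<Sum>h\<in>carrier G. if h = g then a g else 0)" if g: "g \<in> carrier G"
      proof (intro sum.cong refl)
        fix h assume h: "h \<in> carrier G"
        have "inv h \<otimes> g = \<one> \<longleftrightarrow> h = g"
          using inv_solve_left[of \<one> h g] g h by auto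
        then show "a h * group_delta \<one> (inv h \<otimes> g) = (if h = g then a g else 0)"
          by (auto simp: group_delta_def)
      qed
      then show "(a \<otimes>\<^bsub>group_algebra G\<^esub> \<one>\<^bsub>group_algebra G\<^esub>) g = a g"
        using a fin by (auto simp: group_algebra_def)
    qed
  next
    fix a b c
    show "a \<otimes>\<^bsub>group_algebra G\<^esub> b \<otimes>\<^bsub>group_algebra G\<^esub> c =
          a \<otimes>\<^bsub>group_algebra G\<^esub> (b \<otimes>\<^bsub>group_algebra G\<^esub> c)"
    proof
      fix g
      have "(\<Sum>h\<in>carrier G. (\<Sum>k\<in>carrier G. a k * b (inv k \<otimes> h)) * c (inv h \<otimes> g)) =
            (\<Sum>k\<in>carrier G. a k * (\<Sum>h\<in>carrier G. b h * c (inv h \<otimes> (inv k \<otimes> g))))"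
        if g: "g \<in> carrier G"
      proof -
        have "(\<Sum>h\<in>carrier G. (\<Sum>k\<in>carrier G. a k * b (inv k \<otimes> h)) * c (inv h \<otimes> g)) =
              (\<Sum>k\<in>carrier G. \<Sum>h\<in>carrier G. a k * (b (inv k \<otimes> h) * c (inv h \<otimes> g)))"
          by (subst sum.swap) (simp add: sum_distrib_right mult.assoc)
        also have "\<dots> = (\<Sum>k\<in>carrier G. a k *
              (\<Sum>h\<in>carrier G. b (inv k \<otimes> h) * c (inv h \<otimes> g)))"
          by (simp add: sum_distrib_left)
        also have "\<dots> = (\<Sum>k\<in>carrier G. a k *
              (\<Sum>h\<in>carrier G. b h * c (inv h \<otimes> (inv k \<otimes> g))))"
        proof (rule sum.cong[OF refl], rule arg_cong2[where f = "(*)", OF refl])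
          fix k assume k: "k \<in> carrier G"
          have *: "k \<otimes> (inv k \<otimes> y) = y" "inv k \<otimes> (k \<otimes> y) = y" if "y \<in> carrier G" for y
            using k that by (simp_all add: m_assoc[symmetric])
          show "(\<Sum>h\<in>carrier G. b (inv k \<otimes> h) * c (inv h \<otimes> g)) =
                (\<Sum>h\<in>carrier G. b h * c (inv h \<otimes> (inv k \<otimes> g)))"
            by (rule sum.reindex_bij_witness[of _ "\<lambda>h. k \<otimes> h" "\<lambda>h. inv k \<otimes> h"])
               (use k g in \<open>simp_all add: m_assoc inv_mult_group *\<close>)
        qed
        finally show ?thesis .
      qed
      then show "(a \<otimes>\<^bsub>group_algebra G\<^esub> b \<otimes>\<^bsub>group_algebra G\<^esub> c) g =
          (a \<otimes>\<^bsub>group_algebra G\<^esub> (b \<otimes>\<^bsub>group_algebra G\<^esub> c)) g"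
        by (auto simp: group_algebra_def intro!: sum.cong)
    qed
  qed (auto simp: group_algebra_def group_delta_def)
qed (auto simp: group_algebra_def fun_eq_iff algebra_simps sum.distrib)

end

theory Submission
  imports Defs
begin

text \<open>Write \<open>f = 1 - e\<close> and \<open>D = HxH\<close>. For \<open>w \<in> \<complex>[D]\<close> the inclusion \<open>Lw \<subseteq> L\<close> says
  \<open>ew \<in> \<complex>[G]e\<close>, that is \<open>ew = ewe\<close>, that is \<open>ewf = 0\<close>
  (\<open>right_idealizer_principal\<close>). The map \<open>T w = ewf\<close> is an idempotent endomorphism of
  \<open>\<complex>[D]\<close>, because \<open>e\<close> and \<open>f\<close> are idempotents of \<open>\<complex>[H]\<close> and \<open>D\<close> absorbs \<open>H\<close> on both
  sides. So the idealizer is the image of the projection \<open>1 - T\<close>, and its dimension is the trace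
  \<open>|D| - tr T\<close>. Reading \<open>tr T\<close> off the basis \<open>D\<close> gives (\<open>dim_annihilator\<close>)
  \<open>tr T = (\<Sum>d\<in>D. \<Sum>a\<in>H. e(a) f(d\<inverse> a\<inverse> d))\<close>.

  The character of \<open>\<complex>[H]p\<close>, for an idempotent \<open>p \<in> \<complex>[H]\<close>, is a trace of the same kind: right
  multiplication by \<open>p\<close> projects \<open>\<complex>[H]\<close> onto \<open>\<complex>[H]p\<close>, so the value at \<open>k\<close> is the trace of
  \<open>u \<mapsto> kup\<close> on all of \<open>\<complex>[H]\<close>, namely \<open>(\<Sum>h\<in>H. p(h\<inverse> k\<inverse> h))\<close>
  (\<open>principal_character\<close>). The complex conjugate in the inner product is removed by
  \<open>cnj_principal_character\<close>: the action is unitary, so conjugating the character value at \<open>k\<close>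
  gives the value at \<open>k\<inverse>\<close>.

  With \<open>K = H \<inter> xHx\<inverse>\<close> the inner product becomes a sum over \<open>h, h' \<in> H\<close> and \<open>k \<in> K\<close>. The
  range of \<open>k\<close> may be enlarged to \<open>H\<close>, since \<open>f\<close> is supported on \<open>H\<close>, and after substituting
  \<open>k = hah\<inverse>\<close> the summand is the one of \<open>tr T\<close> at \<open>d = h\<inverse>xh'\<close>. Every element of \<open>D\<close>
  arises from exactly \<open>|K|\<close> pairs (\<open>sum_double_coset\<close>), which cancels the factor \<open>1/|K|\<close>
  (\<open>character_inner_principal\<close>).\<close>

section \<open>Traces of linear operators on function spaces\<close>

abbreviation linear_operator :: "(('a \<Rightarrow> complex) \<Rightarrow> 'a \<Rightarrow> complex) \<Rightarrow> bool" where
  "linear_operator \<equiv> Vector_Spaces.linear (\<lambda>c f x. c * f x) (\<lambda>c f x. c * f x)"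

abbreviation linear_functional :: "(('a \<Rightarrow> complex) \<Rightarrow> complex) \<Rightarrow> bool" where
  "linear_functional \<equiv> Vector_Spaces.linear (\<lambda>c f x. c * f x) (*)"

lemma linear_operatorI:
  assumes "\<And>u v. f (u + v) = f u + f v"
    and "\<And>c u. f (\<lambda>x. c * u x) = (\<lambda>x. c * f u x)"
  shows "linear_operator f"
  using assms by unfold_locales auto

lemma linear_functionalI:
  assumes "\<And>u v. \<phi> (u + v) = \<phi> u + \<phi> v"
    and "\<And>c u. \<phi> (\<lambda>x. c * u x) = c * \<phi> u"
  shows "linear_functional \<phi>"
  using assms by unfold_locales (auto simp: algebra_simps)

lemma linear_operator_add:
  "linear_operator f \<Longrightarrow> f (u + v) = f u + f v"
  unfolding Vector_Spaces.linear_def module_hom_def module_hom_axioms_def by blast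

lemma linear_operator_scale:
  "linear_operator f \<Longrightarrow> f (\<lambda>x. c * u x) = (\<lambda>x. c * f u x)"
  unfolding Vector_Spaces.linear_def module_hom_def module_hom_axioms_def by blast

lemma linear_operator_combination:
  assumes "linear_operator f"
  shows "f (\<Sum>i\<in>I. (\<lambda>x. c i * v i x)) = (\<Sum>i\<in>I. (\<lambda>x. c i * f (v i) x))"
proof -
  interpret Vector_Spaces.linear "\<lambda>c f x. c * f x" "\<lambda>c f x. c * f x" f by fact
  show ?thesis by (simp add: sum scale)
qed

lemma linear_functional_combination:
  assumes "linear_functional \<phi>"
  shows "\<phi> (\<Sum>i\<in>I. (\<lambda>x. c i * v i x)) = (\<Sum>i\<in>I. c i * \<phi> (v i))"
proof -
  interpret Vector_Spaces.linear "\<lambda>c f x. c * f x" "(*)" \<phi> by fact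
  show ?thesis by (simp add: sum scale)
qed

text \<open>The basis picked by Hilbert choice in the definition of the trace exists, and it is the same
  one for every operator on \<open>V\<close>.\<close>

lemma trace_on_basis:
  assumes "cfun.subspace V"
  obtains B where "cfun.independent B" "cfun.span B = V"
    "\<And>f. trace_on V f = (\<Sum>b\<in>B. cfun.representation B (f b) b)"
proof -
  define B where "B = (SOME B. cfun.independent B \<and> cfun.span B = V)"
  obtain B0 where "B0 \<subseteq> V" "cfun.independent B0" "V \<subseteq> cfun.span B0"
    by (rule cfun.maximal_independent_subset)
  then have "cfun.independent B0 \<and> cfun.span B0 = V"
    using cfun.span_minimal[OF _ assms] by blast
  then have "cfun.independent B \<and> cfun.span B = V"
    unfolding B_def by (rule someI)
  moreover have "trace_on V f = (\<Sum>b\<in>B. cfun.representation B (f b) b)" for f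
    unfolding trace_on_def B_def Let_def by (rule refl)
  ultimately show ?thesis using that by blast
qed

lemma trace_on_id:
  assumes "cfun.subspace V"
  shows "trace_on V (\<lambda>u. u) = complex_of_nat (cfun.dim V)"
proof -
  obtain B where B: "cfun.independent B" "cfun.span B = V"
      "\<And>f. trace_on V f = (\<Sum>b\<in>B. cfun.representation B (f b) b)"
    using trace_on_basis[OF assms] by blast
  have "cfun.representation B b b = 1" if "b \<in> B" for b
    using cfun.representation_basis[OF B(1) that] by simp
  moreover have "cfun.dim V = card B"
    using B cfun.span_eq_iff[THEN iffD2, OF assms, symmetric] by (intro cfun.dim_eq_card) auto
  ultimately show ?thesis using B(3) by simp
qed

text \<open>A frame of \<open>V\<close> is a family \<open>v\<close> with functionals \<open>\<phi>\<close> such that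
  \<open>u = (\<Sum>i\<in>I. \<phi> i u \<cdot> v i)\<close> on \<open>V\<close>; the \<open>v i\<close> may be linearly dependent. The trace can be
  computed from any frame: \<open>tr\<close> of \<open>u \<mapsto> \<phi> i (f u) \<cdot> v i\<close> is \<open>\<phi> i (f (v i))\<close>, and \<open>f\<close> is the
  sum of these rank-one maps. This makes the arbitrary basis in the definition of the trace
  irrelevant, and it allows the images of the point masses under a projection, as well as an
  orthonormal system, to take the place of a basis.\<close>

lemma trace_on_frame:
  assumes V: "cfun.subspace V" and f: "linear_operator f" "f ` V \<subseteq> V"
    and I: "finite I" and v: "\<And>i. i \<in> I \<Longrightarrow> v i \<in> V"
    and \<phi>: "\<And>i. i \<in> I \<Longrightarrow> linear_functional (\<phi> i)"
    and frame: "\<And>u. u \<in> V \<Longrightarrow> u = (\<Sum>i\<in>I. (\<lambda>x. \<phi> i u * v i x))"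
  shows "trace_on V f = (\<Sum>i\<in>I. \<phi> i (f (v i)))"
proof -
  obtain B where B: "cfun.independent B" "cfun.span B = V"
      and tr: "\<And>f. trace_on V f = (\<Sum>b\<in>B. cfun.representation B (f b) b)"
    using trace_on_basis[OF V] by blast
  have "V \<subseteq> cfun.span (v ` I)"
  proof
    fix u assume "u \<in> V"
    show "u \<in> cfun.span (v ` I)"
      by (subst frame[OF \<open>u \<in> V\<close>]) (intro cfun.span_sum cfun.span_scale cfun.span_base imageI)
  qed
  then have finB: "finite B"
    using cfun.independent_span_bound[of "v ` I" B] B I cfun.span_superset[of B] by auto
  have BV: "b \<in> V" if "b \<in> B" for b
    using B that cfun.span_base by blast
  have "trace_on V f = (\<Sum>b\<in>B. cfun.representation B (f b) b)"
    by (rule tr)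
  also have "\<dots> = (\<Sum>b\<in>B. \<Sum>i\<in>I. \<phi> i (f b) * cfun.representation B (v i) b)"
  proof (rule sum.cong[OF refl])
    fix b assume "b \<in> B"
    then have fb: "f b \<in> V" using BV f by blast
    have "cfun.representation B (f b) b
        = cfun.representation B (\<Sum>i\<in>I. (\<lambda>x. \<phi> i (f b) * v i x)) b"
      using frame[OF fb] by simp
    also have "\<dots> = (\<Sum>i\<in>I. cfun.representation B (\<lambda>x. \<phi> i (f b) * v i x) b)"
      by (subst cfun.representation_sum) (use B v in \<open>auto intro!: cfun.span_scale\<close>)
    also have "\<dots> = (\<Sum>i\<in>I. \<phi> i (f b) * cfun.representation B (v i) b)"
      by (intro sum.cong refl, subst cfun.representation_scale) (use B v in auto)
    finally show "cfun.representation B (f b) b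
        = (\<Sum>i\<in>I. \<phi> i (f b) * cfun.representation B (v i) b)" .
  qed
  also have "\<dots> = (\<Sum>i\<in>I. \<Sum>b\<in>B. cfun.representation B (v i) b * \<phi> i (f b))"
    by (subst sum.swap) (simp add: mult.commute)
  \<comment> \<open>Summing over the basis first reassembles \<open>v i\<close> from its coordinates.\<close>
  also have "\<dots> = (\<Sum>i\<in>I. \<phi> i (f (v i)))"
  proof (rule sum.cong[OF refl])
    fix i assume i: "i \<in> I"
    have "v i = (\<Sum>b\<in>B. (\<lambda>x. cfun.representation B (v i) b * b x))"
      by (rule cfun.sum_representation_eq[symmetric]) (use B v[OF i] finB in auto)
    then have "\<phi> i (f (v i)) = \<phi> i (f (\<Sum>b\<in>B. (\<lambda>x. cfun.representation B (v i) b * b x)))"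
      by simp
    then show "(\<Sum>b\<in>B. cfun.representation B (v i) b * \<phi> i (f b)) = \<phi> i (f (v i))"
      by (simp add: linear_operator_combination[OF f(1)] linear_functional_combination[OF \<phi>[OF i]])
  qed
  finally show ?thesis .
qed

lemma group_span_expansion:
  assumes "finite S" "u \<in> group_span S"
  shows "u = (\<Sum>s\<in>S. (\<lambda>x. u s * group_delta s x))"
proof
  fix x
  have "(\<Sum>s\<in>S. u s * group_delta s x) = (\<Sum>s\<in>S. if s = x then u x else 0)"
    by (intro sum.cong) (auto simp: group_delta_def)
  then show "u x = (\<Sum>s\<in>S. (\<lambda>x. u s * group_delta s x)) x"
    using assms by (auto simp: sum_fun_apply group_span_eq)
qed

lemma linear_functional_eval: "linear_functional (\<lambda>u. u s)"
  by (rule linear_functionalI) auto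

text \<open>The trace of \<open>f\<close> on \<open>V\<close> is the trace of \<open>f \<circ> P\<close> on the whole space, where the diagonal in
  the standard basis is explicit: for \<open>u \<in> V\<close>, \<open>u = P u = (\<Sum>s\<in>S. u s \<cdot> P \<delta>\<^sub>s)\<close>, so the \<open>P \<delta>\<^sub>s\<close>
  with the point evaluations form a frame of \<open>V\<close>.\<close>

lemma trace_on_projection:
  assumes S: "finite S" and V: "cfun.subspace V" "V \<subseteq> group_span S"
    and P: "linear_operator P" "\<And>u. u \<in> group_span S \<Longrightarrow> P u \<in> V" "\<And>u. u \<in> V \<Longrightarrow> P u = u"
    and f: "linear_operator f" "f ` V \<subseteq> V"
  shows "trace_on V f = (\<Sum>s\<in>S. f (P (group_delta s)) s)"
proof (rule trace_on_frame[OF V(1) f S])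
  show "P (group_delta s) \<in> V" if "s \<in> S" for s
    using that by (intro P(2)) (auto simp: group_span_def intro: cfun.span_base)
  show "linear_functional (\<lambda>u. u s)" for s :: 'a by (rule linear_functional_eval)
  fix u assume u: "u \<in> V"
  then have "P u = P (\<Sum>s\<in>S. (\<lambda>x. u s * group_delta s x))"
    using group_span_expansion[OF S] V by auto
  then show "u = (\<Sum>s\<in>S. (\<lambda>x. u s * P (group_delta s) x))"
    by (simp add: linear_operator_combination[OF P(1)] P(3)[OF u])
qed

lemma dim_eq_trace_projection:
  assumes S: "finite S" and V: "cfun.subspace V" "V \<subseteq> group_span S"
    and P: "linear_operator P" "\<And>u. u \<in> group_span S \<Longrightarrow> P u \<in> V" "\<And>u. u \<in> V \<Longrightarrow> P u = u"
  shows "complex_of_nat (cfun.dim V) = (\<Sum>s\<in>S. P (group_delta s) s)"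
proof -
  have "linear_operator (\<lambda>u :: 'a \<Rightarrow> complex. u)" by (rule linear_operatorI) auto
  then show ?thesis
    using trace_on_projection[OF S V P, of "\<lambda>u. u"] trace_on_id[OF V(1)] by simp
qed

section \<open>The trace of an adjoint operator\<close>

text \<open>The standard inner product on \<open>\<complex>\<^sup>S\<close>, conjugate linear in its first argument.\<close>

definition hermitian :: "'a set \<Rightarrow> ('a \<Rightarrow> complex) \<Rightarrow> ('a \<Rightarrow> complex) \<Rightarrow> complex" where
  "hermitian S u v = (\<Sum>s\<in>S. cnj (u s) * v s)"

lemma hermitian_commute: "hermitian S v u = cnj (hermitian S u v)"
  by (simp add: hermitian_def mult.commute)

lemma linear_functional_hermitian: "linear_functional (hermitian S u)"
  by (rule linear_functionalI)
     (auto simp: hermitian_def algebra_simps sum.distrib sum_distrib_left)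

lemma hermitian_unit_multiple:
  assumes "finite S" "r \<in> group_span S" "r \<noteq> 0"
  obtains c where "c \<noteq> 0" "hermitian S (\<lambda>x. c * r x) (\<lambda>x. c * r x) = 1"
proof -
  define n where "n = (\<Sum>s\<in>S. (cmod (r s))\<^sup>2)"
  obtain s where s: "r s \<noteq> 0" using assms(3) by (auto simp: fun_eq_iff)
  then have "s \<in> S" using assms by (auto simp: group_span_eq)
  then have "0 < n"
    unfolding n_def using s assms(1) by (intro sum_pos2[of S s]) auto
  define c where "c = complex_of_real (1 / sqrt n)"
  have cc: "cnj c * c = complex_of_real (1 / n)"
    using \<open>0 < n\<close> by (simp add: c_def flip: of_real_mult)
  have "hermitian S (\<lambda>x. c * r x) (\<lambda>x. c * r x) = (\<Sum>s\<in>S. (cnj c * c) * (cnj (r s) * r s))"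
    by (simp add: hermitian_def algebra_simps)
  also have "\<dots> = (cnj c * c) * (\<Sum>s\<in>S. cnj (r s) * r s)"
    by (simp add: sum_distrib_left)
  also have "(\<Sum>s\<in>S. cnj (r s) * r s) = complex_of_real n"
    unfolding n_def of_real_sum by (intro sum.cong refl) (simp only: complex_norm_square mult.commute)
  also have "(cnj c * c) * complex_of_real n = 1"
    using \<open>0 < n\<close> by (simp add: cc)
  finally show ?thesis using that[of c] \<open>0 < n\<close> by (simp add: c_def)
qed

text \<open>Gram-Schmidt orthonormalisation, with the expansion formula in place of orthonormality as the
  invariant. The expansion alone already implies that \<open>r = b - p\<close> is orthogonal to the span of
  \<open>B\<close>, so nothing else has to be carried through the induction.\<close>

lemma parseval_frame_exists:
  assumes "finite B" "finite S" "B \<subseteq> group_span S"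
  obtains F where "finite F" "F \<subseteq> cfun.span B"
    "\<And>u. u \<in> cfun.span B \<Longrightarrow> u = (\<Sum>w\<in>F. (\<lambda>x. hermitian S w u * w x))"
proof -
  have "\<exists>F. finite F \<and> F \<subseteq> cfun.span B
      \<and> (\<forall>u\<in>cfun.span B. u = (\<Sum>w\<in>F. (\<lambda>x. hermitian S w u * w x)))"
    using assms(1,3)
  proof (induction B rule: finite_induct)
    case empty
    show ?case by (intro exI[of _ "{}"]) auto
  next
    case (insert b B)
    then obtain F where F: "finite F" "F \<subseteq> cfun.span B"
        and frame: "\<And>u. u \<in> cfun.span B \<Longrightarrow> u = (\<Sum>w\<in>F. (\<lambda>x. hermitian S w u * w x))"
      by auto
    define p where "p = (\<Sum>w\<in>F. (\<lambda>x. hermitian S w b * w x))"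
    define r where "r = b - p"
    have p: "p \<in> cfun.span B"
      unfolding p_def using F by (intro cfun.span_sum cfun.span_scale) auto
    have orth: "hermitian S u r = 0" if u: "u \<in> cfun.span B" for u
    proof -
      have "hermitian S u b = cnj (hermitian S b u)" by (rule hermitian_commute)
      also have "hermitian S b u = hermitian S b (\<Sum>w\<in>F. (\<lambda>x. hermitian S w u * w x))"
        using frame[OF u] by simp
      also have "\<dots> = (\<Sum>w\<in>F. hermitian S w u * hermitian S b w)"
        by (rule linear_functional_combination[OF linear_functional_hermitian])
      also have "cnj \<dots> = (\<Sum>w\<in>F. hermitian S w b * hermitian S u w)"
        unfolding cnj_sum complex_cnj_mult hermitian_commute[of S w b for w]
        by (simp only: hermitian_commute[symmetric] mult.commute)
      also have "\<dots> = hermitian S u p"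
        unfolding p_def
        by (rule linear_functional_combination[OF linear_functional_hermitian, symmetric])
      finally show ?thesis
        by (simp add: r_def hermitian_def algebra_simps sum_subtractf)
    qed
    show ?case
    proof (cases "r = 0")
      case True
      then have "b \<in> cfun.span B" using p by (simp add: r_def)
      then have "cfun.span (insert b B) = cfun.span B" by (rule cfun.span_redundant)
      then show ?thesis using F frame by auto
    next
      case False
      have "b \<in> group_span S" "p \<in> group_span S"
        using insert.prems p cfun.span_mono[of B "group_span S"]
        by (auto simp: group_span_def cfun.span_span)
      then have "r \<in> group_span S"
        using assms(2) by (auto simp: r_def group_span_eq)
      with False obtain c where c: "c \<noteq> 0" "hermitian S (\<lambda>x. c * r x) (\<lambda>x. c * r x) = 1"
        using hermitian_unit_multiple[OF assms(2)] by blast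
      \<comment> \<open>The normalised residual of \<open>b\<close> is the new frame vector.\<close>
      define q where "q = (\<lambda>x. c * r x)"
      have q_orth: "hermitian S u q = 0" if "u \<in> cfun.span B" for u
      proof -
        have "hermitian S u q = c * hermitian S u r"
          by (simp add: q_def hermitian_def sum_distrib_left algebra_simps)
        then show ?thesis using orth[OF that] by simp
      qed
      have q_orth': "hermitian S q u = 0" if "u \<in> cfun.span B" for u
        using q_orth[OF that] hermitian_commute[of S q u] by simp
      have qq: "hermitian S q q = 1" using c by (simp add: q_def)
      have "q \<notin> F" using q_orth' F qq by fastforce
      have b_eq: "b = p + (\<lambda>x. inverse c * q x)"
        using c by (auto simp: q_def r_def fun_eq_iff)
      have sub: "cfun.span B \<subseteq> cfun.span (insert b B)"
        by (rule cfun.span_mono) auto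
      have "r \<in> cfun.span (insert b B)"
        unfolding r_def using p sub by (intro cfun.span_diff) (auto intro: cfun.span_base)
      then have qs: "q \<in> cfun.span (insert b B)"
        unfolding q_def by (rule cfun.span_scale)
      have "u = (\<Sum>w\<in>insert q F. (\<lambda>x. hermitian S w u * w x))"
        if u: "u \<in> cfun.span (insert b B)" for u
      proof -
        obtain k where k: "u - (\<lambda>x. k * b x) \<in> cfun.span B"
          using u unfolding cfun.span_insert by auto
        \<comment> \<open>This is \<open>u - k r\<close>, the part of \<open>u\<close> in the span of \<open>B\<close>; adding \<open>k p\<close> back keeps that membership evident.\<close>
        define u0 where "u0 = u - (\<lambda>x. k * b x) + (\<lambda>x. k * p x)"
        define d where "d = k * inverse c"
        have u0: "u0 \<in> cfun.span B"
          unfolding u0_def using k p by (intro cfun.span_add cfun.span_scale)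
        have u_eq: "u = u0 + (\<lambda>x. d * q x)"
        proof
          fix x
          have "k * b x = k * p x + d * q x"
            using fun_cong[OF b_eq, of x] by (simp add: d_def distrib_left mult.assoc)
          then show "u x = (u0 + (\<lambda>x. d * q x)) x" by (simp add: u0_def)
        qed
        have coeff: "hermitian S w u = hermitian S w u0 + d * hermitian S w q" for w
          by (simp add: u_eq hermitian_def sum.distrib sum_distrib_left algebra_simps)
        have "(\<Sum>w\<in>F. (\<lambda>x. hermitian S w u * w x)) = (\<Sum>w\<in>F. (\<lambda>x. hermitian S w u0 * w x))"
          using F q_orth by (intro sum.cong refl) (auto simp: coeff)
        also have "\<dots> = u0" using frame[OF u0] by simp
        finally have "(\<Sum>w\<in>F. (\<lambda>x. hermitian S w u * w x)) = u0" .
        moreover have "hermitian S q u = d"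
          using coeff[of q] q_orth'[OF u0] qq by simp
        ultimately have "(\<Sum>w\<in>insert q F. (\<lambda>x. hermitian S w u * w x)) = (\<lambda>x. d * q x) + u0"
          using F(1) \<open>q \<notin> F\<close> by simp
        then show ?thesis using u_eq by (simp only: add.commute)
      qed
      then show ?thesis
        using F qs sub by (intro exI[of _ "insert q F"]) auto
    qed
  qed
  then show ?thesis using that by blast
qed

text \<open>In a Parseval frame the traces of \<open>f\<close> and \<open>g\<close> are the sums of \<open>\<langle>w, f w\<rangle>\<close> and
  \<open>\<langle>w, g w\<rangle> = \<langle>f w, w\<rangle>\<close>, which are termwise conjugate. This is where a frame taken from the
  Hermitian structure is needed: an arbitrary basis does not express diagonal entries through
  the inner product.\<close>

lemma trace_on_adjoint:
  assumes S: "finite S" and V: "cfun.subspace V" "V \<subseteq> group_span S"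
    and f: "linear_operator f" "f ` V \<subseteq> V" and g: "linear_operator g" "g ` V \<subseteq> V"
    and adj: "\<And>u v. u \<in> V \<Longrightarrow> v \<in> V \<Longrightarrow> hermitian S (f u) v = hermitian S u (g v)"
  shows "trace_on V g = cnj (trace_on V f)"
proof -
  obtain B where B: "B \<subseteq> V" "cfun.independent B" "V \<subseteq> cfun.span B"
    by (rule cfun.maximal_independent_subset)
  have span: "cfun.span B = V"
    using B cfun.span_minimal[OF _ V(1)] by blast
  have "finite B"
    using cfun.independent_span_bound[of "group_delta ` S" B] B V S
    unfolding group_span_def by auto
  then obtain F where F: "finite F" "F \<subseteq> V"
      and frame: "\<And>u. u \<in> V \<Longrightarrow> u = (\<Sum>w\<in>F. (\<lambda>x. hermitian S w u * w x))"
    using parseval_frame_exists[OF _ S, of B] B V span by auto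
  have trace: "trace_on V h = (\<Sum>w\<in>F. hermitian S w (h w))"
    if "linear_operator h" "h ` V \<subseteq> V" for h
    by (rule trace_on_frame[OF V(1) that F(1) _ linear_functional_hermitian frame])
       (use F in auto)
  have "hermitian S w (g w) = cnj (hermitian S w (f w))" if "w \<in> F" for w
    using adj[of w w] F(2) that hermitian_commute[of S "f w" w] by auto
  then show ?thesis
    by (simp add: trace[OF f] trace[OF g])
qed

section \<open>Convolution and support\<close>

context group
begin

abbreviation convolution (infixl "\<star>" 70) where
  "a \<star> b \<equiv> a \<otimes>\<^bsub>group_algebra G\<^esub> b"

lemma convolution_apply:
  "g \<in> carrier G \<Longrightarrow> (a \<star> b) g = (\<Sum>h\<in>carrier G. a h * b (inv h \<otimes> g))"
  by (simp add: group_algebra_def)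

lemma convolution_outside: "g \<notin> carrier G \<Longrightarrow> (a \<star> b) g = 0"
  by (simp add: group_algebra_def)

lemma linear_convolution_left: "linear_operator (\<lambda>u. a \<star> u)"
  by (rule linear_operatorI)
     (auto simp: group_algebra_def fun_eq_iff algebra_simps sum.distrib sum_distrib_left)

lemma linear_convolution_right: "linear_operator (\<lambda>u. u \<star> b)"
  by (rule linear_operatorI)
     (auto simp: group_algebra_def fun_eq_iff algebra_simps sum.distrib sum_distrib_left)

lemma delta_convolution_apply:
  assumes "finite (carrier G)" "g \<in> carrier G" "y \<in> carrier G"
  shows "(group_delta g \<star> b) y = b (inv g \<otimes> y)"
proof -
  have "(\<Sum>h\<in>carrier G. group_delta g h * b (inv h \<otimes> y))
      = (\<Sum>h\<in>carrier G. if h = g then b (inv g \<otimes> y) else 0)"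
    by (intro sum.cong) (auto simp: group_delta_def)
  then show ?thesis using assms by (simp add: convolution_apply)
qed

lemma convolution_support:
  assumes fin: "finite (carrier G)" and KM: "K \<subseteq> carrier G" "M \<subseteq> carrier G"
    and ab: "a \<in> group_span K" "b \<in> group_span M"
  shows "a \<star> b \<in> group_span (K <#> M)"
proof -
  have finKM: "finite K" "finite M" "finite (K <#> M)"
    using KM fin by (auto intro: finite_subset simp: set_mult_def)
  have "(a \<star> b) g = 0" if g: "g \<notin> K <#> M" "g \<in> carrier G" for g
  proof -
    have "a h * b (inv h \<otimes> g) = 0" if h: "h \<in> carrier G" for h
    proof (rule ccontr)
      assume "a h * b (inv h \<otimes> g) \<noteq> 0"
      then have "h \<in> K" "inv h \<otimes> g \<in> M" using ab finKM by (auto simp: group_span_eq)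
      then have "h \<otimes> (inv h \<otimes> g) \<in> K <#> M" by (auto simp: set_mult_def)
      then show False using g h by (simp add: m_assoc[symmetric])
    qed
    then have "(\<Sum>h\<in>carrier G. a h * b (inv h \<otimes> g)) = 0"
      by (intro sum.neutral) blast
    then show ?thesis using g by (simp only: convolution_apply)
  qed
  then show ?thesis
    using convolution_outside finKM by (auto simp: group_span_eq)
qed

lemma convolution_subgroup:
  assumes "finite (carrier G)" "subgroup H G" "a \<in> group_span H" "b \<in> group_span H"
  shows "a \<star> b \<in> group_span H"
  using convolution_support[of H H a b] assms subgroup.subset[OF assms(2)]
  by (simp add: subgroup_mult_id)

lemma group_span_carrier:
  assumes "finite (carrier G)" "K \<subseteq> carrier G"
  shows "group_span K \<subseteq> carrier (group_algebra G)"
  using assms finite_subset[OF assms(2,1)]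
  by (auto simp: group_span_eq carrier_group_algebra)

lemma group_delta_in_span: "g \<in> K \<Longrightarrow> group_delta g \<in> group_span K"
  by (auto simp: group_span_def intro: cfun.span_base)

section \<open>Characters of principal left ideals\<close>

text \<open>Membership in \<open>\<complex>[H]p\<close> is a linear equation because \<open>p\<close> is idempotent; in this form right
  multiplication by \<open>p\<close> is visibly a projection onto \<open>\<complex>[H]p\<close>.\<close>

lemma principal_module_eq:
  assumes fin: "finite (carrier G)" and H: "subgroup H G"
    and p: "p \<in> group_span H" "p \<star> p = p"
  shows "group_span H #>\<^bsub>group_algebra G\<^esub> p = {u \<in> group_span H. u \<star> p = u}"
proof -
  interpret A: ring "group_algebra G" by (rule ring_group_algebra[OF fin])
  have "group_span H \<subseteq> carrier (group_algebra G)"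
    using group_span_carrier[OF fin subgroup.subset[OF H]] .
  then have "u \<star> p \<star> p = u \<star> p" if "u \<in> group_span H" for u
    using that p by (auto simp: A.m_assoc subset_iff)
  then show ?thesis
    using convolution_subgroup[OF fin H _ p(1)] by (force simp: r_coset_def)
qed

lemma principal_module_subspace:
  assumes fin: "finite (carrier G)" and H: "subgroup H G"
    and p: "p \<in> group_span H" "p \<star> p = p"
  shows "cfun.subspace (group_span H #>\<^bsub>group_algebra G\<^esub> p)"
proof -
  have "cfun.subspace (group_span H)" by (simp add: group_span_def)
  moreover have "0 \<star> p = 0"
    by (simp add: group_algebra_def fun_eq_iff)
  ultimately show ?thesis
    unfolding principal_module_eq[OF assms] cfun.subspace_def
    by (auto simp: linear_operator_add[OF linear_convolution_right]
        linear_operator_scale[OF linear_convolution_right])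
qed

lemma delta_convolution_principal_module:
  assumes fin: "finite (carrier G)" and H: "subgroup H G"
    and p: "p \<in> group_span H" "p \<star> p = p" and k: "k \<in> H"
    and u: "u \<in> group_span H #>\<^bsub>group_algebra G\<^esub> p"
  shows "group_delta k \<star> u \<in> group_span H #>\<^bsub>group_algebra G\<^esub> p"
proof -
  interpret A: ring "group_algebra G" by (rule ring_group_algebra[OF fin])
  have sub: "group_span H \<subseteq> carrier (group_algebra G)"
    using group_span_carrier[OF fin subgroup.subset[OF H]] .
  have u': "u \<in> group_span H" "u \<star> p = u" using u by (auto simp: principal_module_eq[OF assms(1-4)])
  have "group_delta k \<star> u \<star> p = group_delta k \<star> u"
    using A.m_assoc[of "group_delta k" u p] sub u' p group_delta_in_span[OF k] by auto
  then show ?thesis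
    using convolution_subgroup[OF fin H group_delta_in_span[OF k] u'(1)]
    by (simp add: principal_module_eq[OF assms(1-4)])
qed

text \<open>The trace of \<open>u \<mapsto> kup\<close> on \<open>\<complex>[H]\<close>: the coefficient of \<open>khp\<close> at \<open>h\<close> is
  \<open>p(h\<inverse>k\<inverse>h)\<close>.\<close>

lemma principal_character:
  assumes fin: "finite (carrier G)" and H: "subgroup H G"
    and p: "p \<in> group_span H" "p \<star> p = p" and k: "k \<in> H"
  shows "module_character G (group_span H #>\<^bsub>group_algebra G\<^esub> p) k
    = (\<Sum>h\<in>H. p (inv h \<otimes> inv k \<otimes> h))"
proof -
  interpret A: ring "group_algebra G" by (rule ring_group_algebra[OF fin])
  let ?V = "group_span H #>\<^bsub>group_algebra G\<^esub> p"
  have HG: "H \<subseteq> carrier G" using H by (rule subgroup.subset)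
  have finH: "finite H" using HG fin by (rule finite_subset)
  have V: "?V = {u \<in> group_span H. u \<star> p = u}"
    by (rule principal_module_eq[OF assms(1-4)])
  have "module_character G ?V k = (\<Sum>h\<in>H. (group_delta k \<star> (group_delta h \<star> p)) h)"
    unfolding module_character_def
  proof (rule trace_on_projection[OF finH principal_module_subspace[OF assms(1-4)] _
        linear_convolution_right _ _ linear_convolution_left])
    show "u \<star> p \<in> ?V" if "u \<in> group_span H" for u
      using that by (auto simp: r_coset_def)
    show "(\<lambda>m. group_delta k \<star> m) ` ?V \<subseteq> ?V"
      using delta_convolution_principal_module[OF assms] by blast
  qed (auto simp: V)
  also have "\<dots> = (\<Sum>h\<in>H. p (inv h \<otimes> inv k \<otimes> h))"
  proof (rule sum.cong[OF refl])
    fix h assume "h \<in> H"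
    then have hk: "h \<in> carrier G" "k \<in> carrier G" using HG k by auto
    then show "(group_delta k \<star> (group_delta h \<star> p)) h = p (inv h \<otimes> inv k \<otimes> h)"
      by (simp add: delta_convolution_apply[OF fin] m_assoc)
  qed
  finally show ?thesis .
qed

text \<open>Left translation by \<open>k\<close> permutes the standard orthonormal basis of \<open>\<complex>[H]\<close>, so its adjoint
  is translation by \<open>k\<inverse>\<close>.\<close>

lemma cnj_principal_character:
  assumes fin: "finite (carrier G)" and H: "subgroup H G"
    and p: "p \<in> group_span H" "p \<star> p = p" and k: "k \<in> H"
  shows "cnj (module_character G (group_span H #>\<^bsub>group_algebra G\<^esub> p) k)
    = module_character G (group_span H #>\<^bsub>group_algebra G\<^esub> p) (inv k)"
proof -
  let ?V = "group_span H #>\<^bsub>group_algebra G\<^esub> p"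
  have HG: "H \<subseteq> carrier G" using H by (rule subgroup.subset)
  have finH: "finite H" using HG fin by (rule finite_subset)
  have k': "inv k \<in> H" using H k by (rule subgroup.m_inv_closed)
  have closed: "(\<lambda>m. group_delta j \<star> m) ` ?V \<subseteq> ?V" if "j \<in> H" for j
    using delta_convolution_principal_module[OF assms(1-4) that] by blast
  have unitary: "hermitian H (group_delta k \<star> u) v = hermitian H u (group_delta (inv k) \<star> v)" for u v
    unfolding hermitian_def
    by (rule sum.reindex_bij_witness[of _ "\<lambda>h. k \<otimes> h" "\<lambda>h. inv k \<otimes> h"])
       (use HG k k' in \<open>auto simp: delta_convolution_apply[OF fin] m_assoc[symmetric] subset_iff
          intro!: subgroup.m_closed[OF H]\<close>)
  show ?thesis
    unfolding module_character_def
    by (rule trace_on_adjoint[OF finH principal_module_subspace[OF assms(1-4)] _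
          linear_convolution_left closed[OF k] linear_convolution_left closed[OF k'] unitary,
          symmetric])
       (auto simp: principal_module_eq[OF assms(1-4)])
qed

section \<open>The idealizer as the kernel of a projection\<close>

text \<open>The space is the kernel of the idempotent \<open>T w = ewf\<close>, hence the image of the projection
  \<open>1 - T\<close>, whose trace is its dimension.\<close>

lemma dim_annihilator:
  assumes fin: "finite (carrier G)" and H: "subgroup H G"
    and D: "D \<subseteq> carrier G" "H <#> D \<subseteq> D" "D <#> H \<subseteq> D"
    and e: "e \<in> group_span H" "e \<star> e = e"
    and f: "f \<in> group_span H" "f \<star> f = f"
  shows "complex_of_nat (cfun.dim {w \<in> group_span D. e \<star> (w \<star> f) = 0})
    = of_nat (card D) - (\<Sum>d\<in>D. \<Sum>a\<in>H. e a * f (inv d \<otimes> inv a \<otimes> d))"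
proof -
  interpret A: ring "group_algebra G" by (rule ring_group_algebra[OF fin])
  have HG: "H \<subseteq> carrier G" using H by (rule subgroup.subset)
  have finH: "finite H" and finD: "finite D" using HG D(1) fin by (auto intro: finite_subset)
  have subH: "group_span H \<subseteq> carrier (group_algebra G)"
    by (rule group_span_carrier[OF fin HG])
  have subD: "group_span D \<subseteq> carrier (group_algebra G)"
    by (rule group_span_carrier[OF fin D(1)])
  have mono: "group_span K \<subseteq> group_span D" if "K \<subseteq> D" for K
    unfolding group_span_def using that by (intro cfun.span_mono) auto
  define T where "T w = e \<star> (w \<star> f)" for w
  have T: "linear_operator T"
    unfolding T_def
    by (rule linear_operatorI)
       (simp_all add: linear_operator_add[OF linear_convolution_left]
         linear_operator_add[OF linear_convolution_right]
         linear_operator_scale[OF linear_convolution_left]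
         linear_operator_scale[OF linear_convolution_right])
  have TD: "T w \<in> group_span D" if "w \<in> group_span D" for w
  proof -
    have "w \<star> f \<in> group_span D"
      using convolution_support[OF fin D(1) HG that f(1)] mono[OF D(3)] by blast
    then show ?thesis
      unfolding T_def using convolution_support[OF fin HG D(1) e(1)] mono[OF D(2)] by blast
  qed
  have TT: "T (T w) = T w" if "w \<in> group_span D" for w
  proof -
    have c: "e \<in> carrier (group_algebra G)" "f \<in> carrier (group_algebra G)"
        "w \<in> carrier (group_algebra G)"
      using e f that subH subD by auto
    have "T (T w) = (e \<star> e) \<star> (w \<star> (f \<star> f))"
      unfolding T_def using c by (simp only: A.m_assoc A.m_closed)
    then show ?thesis using e f by (simp add: T_def)
  qed
  let ?V = "{w \<in> group_span D. T w = 0}"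
  have T0: "T 0 = 0" using linear_operator_scale[OF T, of 0 0] by (simp add: zero_fun_def)
  have V: "cfun.subspace ?V"
    using cfun.subspace_span[of "group_delta ` D"] T0
    unfolding cfun.subspace_def group_span_def[symmetric]
    by (auto simp: linear_operator_add[OF T] linear_operator_scale[OF T] fun_eq_iff)
  have P: "linear_operator (\<lambda>w. w - T w)"
    by (rule linear_operatorI)
       (auto simp: linear_operator_add[OF T] linear_operator_scale[OF T] fun_eq_iff algebra_simps)
  have sub: "w - T w \<in> ?V" if w: "w \<in> group_span D" for w
  proof -
    have "T (w - T w + T w) = T (w - T w) + T (T w)" by (rule linear_operator_add[OF T])
    then have "T (w - T w) = 0" by (simp add: TT[OF w])
    then show ?thesis using w TD[OF w] by (auto simp: group_span_eq finD)
  qed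
  have "complex_of_nat (cfun.dim ?V) = (\<Sum>d\<in>D. (group_delta d - T (group_delta d)) d)"
    by (rule dim_eq_trace_projection[OF finD V _ P sub]) auto
  also have "\<dots> = (\<Sum>d\<in>D. 1 - (\<Sum>a\<in>H. e a * f (inv d \<otimes> inv a \<otimes> d)))"
  proof (rule sum.cong[OF refl])
    fix d assume "d \<in> D"
    then have d: "d \<in> carrier G" using D by auto
    have "T (group_delta d) d = (\<Sum>a\<in>carrier G. e a * (group_delta d \<star> f) (inv a \<otimes> d))"
      unfolding T_def using d by (rule convolution_apply)
    also have "\<dots> = (\<Sum>a\<in>carrier G. e a * f (inv d \<otimes> inv a \<otimes> d))"
      using d by (intro sum.cong refl) (simp add: delta_convolution_apply[OF fin] m_assoc)
    also have "\<dots> = (\<Sum>a\<in>H. e a * f (inv d \<otimes> inv a \<otimes> d))"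
      using fin HG e(1) by (intro sum.mono_neutral_right) (auto simp: group_span_eq finH)
    finally show "(group_delta d - T (group_delta d)) d
        = 1 - (\<Sum>a\<in>H. e a * f (inv d \<otimes> inv a \<otimes> d))"
      by (simp add: group_delta_def)
  qed
  finally show ?thesis by (simp add: T_def sum_subtractf)
qed

lemma group_algebra_minus:
  assumes fin: "finite (carrier G)"
    and ab: "a \<in> carrier (group_algebra G)" "b \<in> carrier (group_algebra G)"
  shows "a \<ominus>\<^bsub>group_algebra G\<^esub> b = a - b"
proof -
  interpret A: ring "group_algebra G" by (rule ring_group_algebra[OF fin])
  have "(a \<ominus>\<^bsub>group_algebra G\<^esub> b) \<oplus>\<^bsub>group_algebra G\<^esub> b = a"
    using ab by (simp add: A.minus_eq A.a_assoc A.l_neg)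
  then have "(a \<ominus>\<^bsub>group_algebra G\<^esub> b) + b = a" by (simp add: group_algebra_def)
  then show ?thesis by (simp add: eq_diff_eq)
qed

text \<open>Since \<open>e\<close> itself lies in \<open>L\<close>, the inclusion \<open>Lw \<subseteq> L\<close> forces \<open>ew \<in> L\<close>, so right
  multiplication by \<open>e\<close> fixes \<open>ew\<close>. Conversely \<open>ew = ewe\<close> gives \<open>aew = (aew)e \<in> L\<close>.\<close>

lemma right_idealizer_principal:
  assumes fin: "finite (carrier G)" and D: "D \<subseteq> carrier G"
    and e: "e \<in> carrier (group_algebra G)" "e \<star> e = e"
  shows "right_idealizer G D (group_span (carrier G) #>\<^bsub>group_algebra G\<^esub> e)
    = {w \<in> group_span D. e \<star> (w \<star> (\<one>\<^bsub>group_algebra G\<^esub> \<ominus>\<^bsub>group_algebra G\<^esub> e)) = 0}"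
proof -
  interpret A: ring "group_algebra G" by (rule ring_group_algebra[OF fin])
  let ?A = "carrier (group_algebra G)"
  let ?L = "?A #>\<^bsub>group_algebra G\<^esub> e"
  have "?L #>\<^bsub>group_algebra G\<^esub> w \<subseteq> ?L \<longleftrightarrow>
      e \<star> (w \<star> (\<one>\<^bsub>group_algebra G\<^esub> \<ominus>\<^bsub>group_algebra G\<^esub> e)) = 0"
    if w: "w \<in> ?A" for w
  proof -
    have "e \<star> (w \<star> (\<one>\<^bsub>group_algebra G\<^esub> \<ominus>\<^bsub>group_algebra G\<^esub> e))
        = (e \<star> w) \<ominus>\<^bsub>group_algebra G\<^esub> (e \<star> w \<star> e)"
      using e w by (simp add: A.minus_eq A.r_distr A.r_minus A.m_assoc)
    also have "\<dots> = e \<star> w - e \<star> w \<star> e"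
      using e w by (intro group_algebra_minus[OF fin]) auto
    finally have *: "e \<star> (w \<star> (\<one>\<^bsub>group_algebra G\<^esub> \<ominus>\<^bsub>group_algebra G\<^esub> e)) = 0
        \<longleftrightarrow> e \<star> w = e \<star> w \<star> e"
      by simp
    show ?thesis
      unfolding *
    proof
      assume sub: "?L #>\<^bsub>group_algebra G\<^esub> w \<subseteq> ?L"
      have "e \<in> ?L" using e by (force simp: r_coset_def)
      then have "e \<star> w \<in> ?L #>\<^bsub>group_algebra G\<^esub> w"
        unfolding r_coset_def[of _ ?L w] by blast
      then have "e \<star> w \<in> ?L" using sub by blast
      then obtain a where "a \<in> ?A" "e \<star> w = a \<star> e" by (auto simp: r_coset_def)
      then show "e \<star> w = e \<star> w \<star> e" using e by (simp add: A.m_assoc)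
    next
      assume ew: "e \<star> w = e \<star> w \<star> e"
      have "a \<star> e \<star> w \<in> ?L" if a: "a \<in> ?A" for a
      proof -
        have "a \<star> e \<star> w = a \<star> (e \<star> w)" using a e w by (simp add: A.m_assoc)
        also have "\<dots> = a \<star> (e \<star> w \<star> e)" using ew by simp
        also have "\<dots> = a \<star> (e \<star> w) \<star> e" using a e w by (simp add: A.m_assoc)
        finally show ?thesis using a e w by (auto simp: r_coset_def)
      qed
      then show "?L #>\<^bsub>group_algebra G\<^esub> w \<subseteq> ?L" by (auto simp: r_coset_def)
    qed
  qed
  then show ?thesis
    using group_span_carrier[OF fin D]
    unfolding right_idealizer_def carrier_group_algebra[OF fin] by blast
qed

section \<open>Double cosets\<close>

lemma double_coset_eq:
  assumes "subgroup H G" "x \<in> carrier G"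
  shows "double_coset G H x = (\<lambda>(h, h'). h \<otimes> x \<otimes> h') ` (H \<times> H)"
proof -
  have "h \<otimes> (x \<otimes> h') = h \<otimes> x \<otimes> h'" if "h \<in> H" "h' \<in> H" for h h'
    using subgroup.subset[OF assms(1)] assms(2) that by (simp add: m_assoc subset_iff)
  then show ?thesis
    by (force simp: double_coset_def set_mult_def l_coset_def)
qed

lemma double_coset_absorb:
  assumes H: "subgroup H G" and x: "x \<in> carrier G"
  shows "double_coset G H x \<subseteq> carrier G"
    and "H <#> double_coset G H x \<subseteq> double_coset G H x"
    and "double_coset G H x <#> H \<subseteq> double_coset G H x"
proof -
  have HG: "h \<in> carrier G" if "h \<in> H" for h using subgroup.subset[OF H] that by blast
  note cl = subgroup.m_closed[OF H]
  show "double_coset G H x \<subseteq> carrier G"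
    using x by (auto simp: double_coset_eq[OF H x] HG)
  have "k \<otimes> (h \<otimes> x \<otimes> h') \<in> double_coset G H x" if "k \<in> H" "h \<in> H" "h' \<in> H" for k h h'
    unfolding double_coset_eq[OF H x] using that x
    by (intro image_eqI[of _ _ "(k \<otimes> h, h')"]) (auto simp: HG m_assoc cl)
  then show "H <#> double_coset G H x \<subseteq> double_coset G H x"
    by (auto simp: set_mult_def) (auto simp: double_coset_eq[OF H x])
  have "(h \<otimes> x \<otimes> h') \<otimes> k \<in> double_coset G H x" if "k \<in> H" "h \<in> H" "h' \<in> H" for k h h'
    unfolding double_coset_eq[OF H x] using that x
    by (intro image_eqI[of _ _ "(h, h' \<otimes> k)"]) (auto simp: HG m_assoc cl)
  then show "double_coset G H x <#> H \<subseteq> double_coset G H x"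
    by (auto simp: set_mult_def) (auto simp: double_coset_eq[OF H x])
qed

lemma inv_cancel:
  assumes "a \<in> carrier G" "y \<in> carrier G"
  shows "a \<otimes> (inv a \<otimes> y) = y" "inv a \<otimes> (a \<otimes> y) = y"
  using assms by (simp_all add: m_assoc[symmetric])

lemma conjugate_inter_iff:
  assumes H: "subgroup H G" and x: "x \<in> carrier G"
  shows "k \<in> H \<inter> (x <# H #> inv x) \<longleftrightarrow> k \<in> H \<and> inv x \<otimes> k \<otimes> x \<in> H"
proof -
  have HG: "h \<in> carrier G" if "h \<in> H" for h using subgroup.subset[OF H] that by blast
  have "k \<in> x <# H #> inv x \<longleftrightarrow> inv x \<otimes> k \<otimes> x \<in> H" if k: "k \<in> H"
  proof
    assume "k \<in> x <# H #> inv x"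
    then obtain h where h: "h \<in> H" "k = x \<otimes> h \<otimes> inv x"
      by (auto simp: l_coset_def r_coset_def)
    then have "inv x \<otimes> k \<otimes> x = h" using x HG[OF h(1)] by (simp add: m_assoc inv_cancel)
    then show "inv x \<otimes> k \<otimes> x \<in> H" using h by simp
  next
    assume h: "inv x \<otimes> k \<otimes> x \<in> H"
    have "k = x \<otimes> (inv x \<otimes> k \<otimes> x) \<otimes> inv x"
      using x HG[OF k] by (simp add: m_assoc inv_cancel)
    then show "k \<in> x <# H #> inv x" using h by (auto simp: l_coset_def r_coset_def)
  qed
  then show ?thesis by blast
qed

text \<open>The fibre of \<open>(h, h') \<mapsto> hxh'\<close> over \<open>d = h\<^sub>0xh\<^sub>1\<close> is a torsor under \<open>K = H \<inter> xHx\<inverse>\<close>: an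
  element \<open>k \<in> H\<close> inserted on the left of \<open>x\<close> is compensated by \<open>x\<inverse>k\<inverse>x\<close> on the right, and
  this factor lies in \<open>H\<close> exactly when \<open>k \<in> K\<close>.\<close>

lemma sum_double_coset:
  fixes F :: "'a \<Rightarrow> complex"
  assumes fin: "finite (carrier G)" and H: "subgroup H G" and x: "x \<in> carrier G"
  shows "(\<Sum>h\<in>H. \<Sum>h'\<in>H. F (h \<otimes> x \<otimes> h'))
    = of_nat (card (H \<inter> (x <# H #> inv x))) * (\<Sum>d\<in>double_coset G H x. F d)"
proof -
  have HG: "h \<in> carrier G" if "h \<in> H" for h using subgroup.subset[OF H] that by blast
  note cl = subgroup.m_closed[OF H] subgroup.m_inv_closed[OF H]
  have finH: "finite H" using subgroup.subset[OF H] fin by (rule finite_subset)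
  let ?K = "H \<inter> (x <# H #> inv x)" and ?m = "\<lambda>(h, h'). h \<otimes> x \<otimes> h'"
  have D: "double_coset G H x = ?m ` (H \<times> H)" by (rule double_coset_eq[OF H x])
  have fibre: "card {q \<in> H \<times> H. ?m q = d} = card ?K" if "d \<in> double_coset G H x" for d
  proof -
    from that obtain h0 h1 where h: "h0 \<in> H" "h1 \<in> H" and d: "d = h0 \<otimes> x \<otimes> h1"
      by (auto simp: D)
    have "bij_betw (\<lambda>k. (h0 \<otimes> k, inv x \<otimes> inv k \<otimes> x \<otimes> h1)) ?K {q \<in> H \<times> H. ?m q = d}"
    proof (rule bij_betwI[where g = "\<lambda>(h, h'). inv h0 \<otimes> h"])
      show "(\<lambda>k. (h0 \<otimes> k, inv x \<otimes> inv k \<otimes> x \<otimes> h1)) \<in> ?K \<rightarrow> {q \<in> H \<times> H. ?m q = d}"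
      proof
        fix k assume "k \<in> ?K"
        then have k: "k \<in> H" "inv x \<otimes> k \<otimes> x \<in> H"
          using conjugate_inter_iff[OF H x] by auto
        have "inv x \<otimes> inv k \<otimes> x = inv (inv x \<otimes> k \<otimes> x)"
          using k x by (simp add: HG inv_mult_group m_assoc)
        then have "inv x \<otimes> inv k \<otimes> x \<otimes> h1 \<in> H"
          using k h by (simp add: cl)
        then show "(h0 \<otimes> k, inv x \<otimes> inv k \<otimes> x \<otimes> h1) \<in> {q \<in> H \<times> H. ?m q = d}"
          using k h x by (simp add: d cl HG m_assoc inv_cancel)
      qed
      show "(\<lambda>(h, h'). inv h0 \<otimes> h) \<in> {q \<in> H \<times> H. ?m q = d} \<rightarrow> ?K"
      proof
        fix q assume "q \<in> {q \<in> H \<times> H. ?m q = d}"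
        then obtain a b where q: "q = (a, b)" and ab: "a \<in> H" "b \<in> H"
            and eq: "a \<otimes> x \<otimes> b = d"
          by auto
        have "inv h0 \<otimes> a \<in> H" using ab h by (simp add: cl)
        have "inv x \<otimes> (inv h0 \<otimes> a) \<otimes> x = inv x \<otimes> inv h0 \<otimes> (a \<otimes> x \<otimes> b) \<otimes> inv b"
          using ab h x by (simp add: HG m_assoc)
        also have "\<dots> = h1 \<otimes> inv b"
          unfolding eq d using ab h x by (simp add: HG m_assoc inv_cancel)
        also have "\<dots> \<in> H" using ab h by (simp add: cl)
        finally have "inv x \<otimes> (inv h0 \<otimes> a) \<otimes> x \<in> H" .
        with \<open>inv h0 \<otimes> a \<in> H\<close> show "(\<lambda>(h, h'). inv h0 \<otimes> h) q \<in> ?K"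
          by (simp only: q prod.case conjugate_inter_iff[OF H x])
      qed
      show "(\<lambda>(h, h'). inv h0 \<otimes> h) (h0 \<otimes> k, inv x \<otimes> inv k \<otimes> x \<otimes> h1) = k" if "k \<in> ?K" for k
        using that h by (simp add: HG inv_cancel)
      show "(h0 \<otimes> (\<lambda>(h, h'). inv h0 \<otimes> h) q,
          inv x \<otimes> inv ((\<lambda>(h, h'). inv h0 \<otimes> h) q) \<otimes> x \<otimes> h1) = q"
        if "q \<in> {q \<in> H \<times> H. ?m q = d}" for q
      proof -
        obtain a b where q: "q = (a, b)" by (cases q)
        then have ab: "a \<in> H" "b \<in> H" "a \<otimes> x \<otimes> b = d" using that by auto
        have "inv x \<otimes> inv (inv h0 \<otimes> a) \<otimes> x \<otimes> h1 = inv x \<otimes> inv a \<otimes> (h0 \<otimes> x \<otimes> h1)"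
          using ab(1,2) h x by (simp add: HG m_assoc inv_mult_group)
        also have "\<dots> = b"
          unfolding d[symmetric] ab(3)[symmetric]
          using ab(1,2) x by (simp add: HG m_assoc inv_cancel)
        finally show ?thesis using ab(1,2) h by (simp add: q HG inv_cancel)
      qed
    qed
    then show ?thesis by (simp add: bij_betw_same_card)
  qed
  have "(\<Sum>h\<in>H. \<Sum>h'\<in>H. F (h \<otimes> x \<otimes> h')) = (\<Sum>q\<in>H \<times> H. F (?m q))"
    by (simp add: sum.cartesian_product case_prod_unfold)
  also have "\<dots> = (\<Sum>d\<in>double_coset G H x. \<Sum>q | q \<in> H \<times> H \<and> ?m q = d. F (?m q))"
    by (rule sum.group[symmetric]) (auto simp: D finH)
  also have "\<dots> = (\<Sum>d\<in>double_coset G H x. of_nat (card ?K) * F d)"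
  proof (rule sum.cong[OF refl])
    fix d assume d: "d \<in> double_coset G H x"
    have "(\<Sum>q | q \<in> H \<times> H \<and> ?m q = d. F (?m q)) = (\<Sum>q | q \<in> H \<times> H \<and> ?m q = d. F d)"
      by (rule sum.cong) auto
    then show "(\<Sum>q | q \<in> H \<times> H \<and> ?m q = d. F (?m q)) = of_nat (card ?K) * F d"
      using fibre[OF d] by simp
  qed
  finally show ?thesis by (simp add: sum_distrib_left)
qed

section \<open>The inner product of the characters\<close>

text \<open>Both sides are the trace of \<open>w \<mapsto> ewf\<close> on \<open>\<complex>[HxH]\<close>; the inner product sees it through the
  parametrisation of the double coset by \<open>H \<times> H\<close>.\<close>

lemma character_inner_principal:
  assumes fin: "finite (carrier G)" and H: "subgroup H G" and x: "x \<in> carrier G"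
    and e: "e \<in> group_span H" "e \<star> e = e"
    and f: "f \<in> group_span H" "f \<star> f = f"
  shows "character_inner (H \<inter> (x <# H #> inv x))
      (module_character G (group_span H #>\<^bsub>group_algebra G\<^esub> e))
      (conj_character G x (module_character G (group_span H #>\<^bsub>group_algebra G\<^esub> f)))
    = (\<Sum>d\<in>double_coset G H x. \<Sum>a\<in>H. e a * f (inv d \<otimes> inv a \<otimes> d))"
proof -
  have HG: "h \<in> carrier G" if "h \<in> H" for h using subgroup.subset[OF H] that by blast
  note cl = subgroup.m_closed[OF H] subgroup.m_inv_closed[OF H]
  have finH: "finite H" using subgroup.subset[OF H] fin by (rule finite_subset)
  let ?K = "H \<inter> (x <# H #> inv x)"
  define E where "E k = (\<Sum>h\<in>H. e (inv h \<otimes> k \<otimes> h))" for k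
  define F where "F k = (\<Sum>h\<in>H. f (inv h \<otimes> (inv x \<otimes> inv k \<otimes> x) \<otimes> h))" for k
  define S where "S d = (\<Sum>a\<in>H. e a * f (inv d \<otimes> inv a \<otimes> d))" for d
  have K: "k \<in> H" "inv x \<otimes> k \<otimes> x \<in> H" if "k \<in> ?K" for k
    using that conjugate_inter_iff[OF H x] by auto
  have chi_e: "cnj (module_character G (group_span H #>\<^bsub>group_algebra G\<^esub> e) k) = E k"
    if "k \<in> ?K" for k
    unfolding cnj_principal_character[OF fin H e K(1)[OF that]]
    using K(1)[OF that] by (simp add: principal_character[OF fin H e] cl E_def HG)
  have chi_f: "conj_character G x (module_character G (group_span H #>\<^bsub>group_algebra G\<^esub> f)) k = F k"
    if "k \<in> ?K" for k
    using K[OF that] x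
    by (simp add: conj_character_def principal_character[OF fin H f] F_def HG inv_mult_group m_assoc)
  \<comment> \<open>Terms with \<open>k\<close> outside \<open>xHx\<inverse>\<close> vanish, so the sum over \<open>K\<close> extends to \<open>H\<close>.\<close>
  have F0: "F k = 0" if k: "k \<in> H - ?K" for k
  proof -
    have "f (inv h \<otimes> (inv x \<otimes> inv k \<otimes> x) \<otimes> h) = 0" if h: "h \<in> H" for h
    proof (rule ccontr)
      let ?y = "inv h \<otimes> (inv x \<otimes> inv k \<otimes> x) \<otimes> h"
      assume "f ?y \<noteq> 0"
      then have "?y \<in> H" using f(1) finH by (auto simp: group_span_eq)
      then have "inv (h \<otimes> ?y \<otimes> inv h) \<in> H" using h by (simp add: cl)
      also have "inv (h \<otimes> ?y \<otimes> inv h) = inv x \<otimes> k \<otimes> x"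
        using h k x by (simp add: HG m_assoc inv_mult_group inv_cancel)
      finally show False using k conjugate_inter_iff[OF H x] by auto
    qed
    then show ?thesis by (simp add: F_def)
  qed
  \<comment> \<open>Substituting \<open>k = hah\<inverse>\<close> merges the two conjugations into one by \<open>h\<inverse>xh'\<close>.\<close>
  have inner: "(\<Sum>k\<in>H. e (inv h \<otimes> k \<otimes> h) * f (inv h' \<otimes> (inv x \<otimes> inv k \<otimes> x) \<otimes> h'))
      = S (inv h \<otimes> x \<otimes> h')" if h: "h \<in> H" "h' \<in> H" for h h'
    unfolding S_def
    by (rule sum.reindex_bij_witness[of _ "\<lambda>a. h \<otimes> a \<otimes> inv h" "\<lambda>k. inv h \<otimes> k \<otimes> h"])
       (use h x in \<open>simp_all add: cl HG m_assoc inv_mult_group inv_cancel\<close>)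
  have "(\<Sum>k\<in>?K. E k * F k) = (\<Sum>k\<in>H. E k * F k)"
    by (rule sum.mono_neutral_left) (use finH F0 in auto)
  also have "\<dots> = (\<Sum>k\<in>H. \<Sum>h\<in>H. \<Sum>h'\<in>H.
      e (inv h \<otimes> k \<otimes> h) * f (inv h' \<otimes> (inv x \<otimes> inv k \<otimes> x) \<otimes> h'))"
    by (simp add: E_def F_def sum_product)
  also have "\<dots> = (\<Sum>h\<in>H. \<Sum>h'\<in>H. \<Sum>k\<in>H.
      e (inv h \<otimes> k \<otimes> h) * f (inv h' \<otimes> (inv x \<otimes> inv k \<otimes> x) \<otimes> h'))"
    by (subst sum.swap, rule sum.cong[OF refl], rule sum.swap)
  also have "\<dots> = (\<Sum>h\<in>H. \<Sum>h'\<in>H. S (inv h \<otimes> x \<otimes> h'))"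
    by (intro sum.cong refl inner)
  also have "\<dots> = (\<Sum>h\<in>H. \<Sum>h'\<in>H. S (h \<otimes> x \<otimes> h'))"
    by (rule sum.reindex_bij_witness[of _ "\<lambda>h. inv h" "\<lambda>h. inv h"]) (auto simp: cl HG)
  also have "\<dots> = of_nat (card ?K) * (\<Sum>d\<in>double_coset G H x. S d)"
    by (rule sum_double_coset[OF fin H x])
  finally have sum: "(\<Sum>k\<in>?K. E k * F k) = of_nat (card ?K) * (\<Sum>d\<in>double_coset G H x. S d)" .
  have "\<one> \<in> ?K"
    using x by (simp only: conjugate_inter_iff[OF H x]) (simp add: subgroup.one_closed[OF H])
  then have "card ?K \<noteq> 0" using finH by auto
  then show ?thesis
    using sum by (simp add: character_inner_def chi_e chi_f S_def)
qed

end

lemma character_inner_restrict: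
  "character_inner K (restrict \<chi> K) (restrict \<psi> K) = character_inner K \<chi> \<psi>"
  by (simp add: character_inner_def)

theorem proposition12p6:
  fixes G :: "('a, 'b) monoid_scheme" (structure)
    and H :: "'a set" and x :: 'a
    and e :: "'a \<Rightarrow> complex" and L :: "('a \<Rightarrow> complex) set"
  assumes "group G" and "finite (carrier G)"
    and "subgroup H G" and "x \<in> carrier G"
    and "e \<in> group_span H" and "e \<otimes>\<^bsub>group_algebra G\<^esub> e = e"
    and "L = group_span (carrier G) #>\<^bsub>group_algebra G\<^esub> e"
  shows "complex_of_nat (cfun.dim (right_idealizer G (double_coset G H x) L)) =
    complex_of_nat (card (double_coset G H x)) -
    character_inner (H \<inter> (x <# H #> inv x))
      (restrict (module_character G (group_span H #>\<^bsub>group_algebra G\<^esub> e))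
        (H \<inter> (x <# H #> inv x)))
      (restrict (conj_character G x (module_character G
          (group_span H #>\<^bsub>group_algebra G\<^esub>
            (\<one>\<^bsub>group_algebra G\<^esub> \<ominus>\<^bsub>group_algebra G\<^esub> e))))
        (H \<inter> (x <# H #> inv x)))"
proof -
  interpret group G by fact
  interpret A: ring "group_algebra G" by (rule ring_group_algebra[OF assms(2)])
  note fin = assms(2) and H = assms(3) and x = assms(4) and e = assms(5,6)
  have HG: "H \<subseteq> carrier G" using H by (rule subgroup.subset)
  have finH: "finite H" using HG fin by (rule finite_subset)
  have eA: "e \<in> carrier (group_algebra G)"
    using e(1) group_span_carrier[OF fin HG] by blast
  define f where "f = \<one>\<^bsub>group_algebra G\<^esub> \<ominus>\<^bsub>group_algebra G\<^esub> e"
  have "f = group_delta \<one> - e"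
    unfolding f_def group_algebra_minus[OF fin A.one_closed eA] by (simp add: group_algebra_def)
  moreover have "group_delta \<one> \<in> group_span H"
    by (rule group_delta_in_span) (rule subgroup.one_closed[OF H])
  ultimately have fH: "f \<in> group_span H"
    using e(1) by (simp add: group_span_eq[OF finH])
  have ff: "f \<otimes>\<^bsub>group_algebra G\<^esub> f = f"
    unfolding f_def using eA e(2)
    by (simp add: A.minus_eq A.l_distr A.r_distr A.l_minus A.r_minus A.r_neg A.l_neg)
  show ?thesis
    unfolding assms(7) character_inner_restrict
      right_idealizer_principal[OF fin double_coset_absorb(1)[OF H x] eA e(2)]
      f_def[symmetric] character_inner_principal[OF fin H x e fH ff]
    by (rule dim_annihilator[OF fin H double_coset_absorb[OF H x] e fH ff])
qed

end
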